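(* Let $y$ be a grid function on $\bar\omega$ satisfying $$\gamma(\boldsymbol x)y(\boldsymbol x)-\alpha_1(\boldsymbol x)y(x_1-h_1,x_2)-\beta_1(\boldsymbol x)y(x_1+h_1,x_2)-\alpha_2(\boldsymbol x)y(x_1,x_2-h_2)-\beta_2(\boldsymbol x)y(x_1,x_2+h_2)=\varphi(\boldsymbol x),\quad \boldsymbol x\in\omega,$$ $$y(\boldsymbol x)=0,\quad \boldsymbol x\in\partial\omega,$$ where $\gamma(\boldsymbol x)>0$ for $\boldsymbol x\in\omega$ and $\alpha_j(\boldsymbol x)>0$, $\beta_j(\boldsymbol x)>0$, $j=1,2$, for all $\boldsymbol x\in\omega\cup\partial\omega$. Assume that $\varphi(\boldsymbol x)\ge 0$ for all $\boldsymbol x\in\omega$ (or, respectively, $\varphi(\boldsymbol x)\le 0$ for all $\boldsymbol x\in\omega$). If either $$\gamma(\boldsymbol x)\ge\alpha_1(\boldsymbol x)+\alpha_2(\boldsymbol x)+\beta_1(\boldsymbol x)+\beta_2(\boldsymbol x),\quad \boldsymbol x\in\omega,$$ or $$\gamma(\boldsymbol x)\ge\alpha_1(x_1+h_1,x_2)+\beta_1(x_1-h_1,x_2)+\alpha_2(x_1,x_2+h_2)+\beta_2(x_1,x_2-h_2),\quad \boldsymbol x\in\omega,$$ then $y(\boldsymbol x)\ge 0$ for all $\boldsymbol x\in\omega$ (respectively, $y(\boldsymbol x)\le 0$ for all $\boldsymbol x\in\omega$).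
   Context: For $\alpha=1,2$ let $l_\alpha>0$, $N_\alpha\ge 2$ an integer, $h_\alpha=l_\alpha/N_\alpha$, $\bar\omega_\alpha=\{i h_\alpha : i=0,1,\dots,N_\alpha\}$ and $\omega_\alpha=\{i h_\alpha : i=1,\dots,N_\alpha-1\}$. Then $\bar\omega=\bar\omega_1\times\bar\omega_2$, $\omega=\omega_1\times\omega_2$ is the set of interior nodes, $\partial\omega=\bar\omega\setminus\omega$ is the set of boundary nodes, and $\boldsymbol x=(x_1,x_2)$. All functions are real valued. *)

theory Defs
  imports Complex_Main
begin

definition nodes_1d :: "real \<Rightarrow> nat \<Rightarrow> real set" where
  "nodes_1d h N = {real i * h | i. 0 \<le> i \<and> i \<le> N}"

definition interior_nodes_1d :: "real \<Rightarrow> nat \<Rightarrow> real set" where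
  "interior_nodes_1d h N = {real i * h | i. 1 \<le> i \<and> i \<le> N - 1}"

definition grid :: "real \<Rightarrow> nat \<Rightarrow> real \<Rightarrow> nat \<Rightarrow> (real \<times> real) set" where
  "grid h1 N1 h2 N2 = nodes_1d h1 N1 \<times> nodes_1d h2 N2"

definition interior_grid :: "real \<Rightarrow> nat \<Rightarrow> real \<Rightarrow> nat \<Rightarrow> (real \<times> real) set" where
  "interior_grid h1 N1 h2 N2 = interior_nodes_1d h1 N1 \<times> interior_nodes_1d h2 N2"

definition boundary_grid :: "real \<Rightarrow> nat \<Rightarrow> real \<Rightarrow> nat \<Rightarrow> (real \<times> real) set" where
  "boundary_grid h1 N1 h2 N2 = grid h1 N1 h2 N2 - interior_grid h1 N1 h2 N2"

end

theory Submission imports Defs "HOL-Analysis.Product_Vector" begin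

text \<open>Let \<open>P\<close> be the set where \<open>y\<close> is negative and \<open>z\<close> the negative part of \<open>y\<close>; the equation
  bounds \<open>\<gamma> z\<close> on \<open>P\<close> by the weighted sum of the neighbouring values of \<open>z\<close>. Under the first
  dominance condition this makes the set of maximisers of \<open>z\<close> invariant under a translation.
  Under the second one, summing over \<open>P\<close> and moving the shifts from \<open>z\<close> onto the
  coefficients makes \<open>P\<close> itself invariant under a translation. A nonempty finite set
  is never invariant under a nonzero translation.\<close>

text \<open>Otherwise the translation by \<open>e\<close> would map \<open>P\<close> injectively
  into itself, hence permute it by finiteness. Comparing the sum of the elements before and after
  then gives \<open>card P\<close> times \<open>e\<close> equal to zero.\<close>

lemma finite_exit_translation:
  fixes e :: "'a::real_vector"
  assumes "finite P" "P \<noteq> {}" "e \<noteq> 0"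
  shows "\<exists>w\<in>P. w + e \<notin> P"
proof (rule ccontr)
  assume "\<not> ?thesis"
  then have sub: "(\<lambda>w. w + e) ` P \<subseteq> P" by auto
  have inj: "inj_on (\<lambda>w. w + e) P" by (auto simp: inj_on_def)
  have img: "(\<lambda>w. w + e) ` P = P"
    by (rule endo_inj_surj[OF \<open>finite P\<close> sub inj])
  have "\<Sum>P = \<Sum>((\<lambda>w. w + e) ` P)" by (simp only: img)
  also have "\<dots> = (\<Sum>w\<in>P. w + e)" by (simp only: sum.reindex[OF inj] comp_def)
  also have "\<dots> = \<Sum>P + real (card P) *\<^sub>R e"
    by (simp add: sum.distrib sum_constant_scaleR del: sum_constant)
  finally show False using assms by simp
qed

text \<open>Summation by parts with zero extension: terms with \<open>x - e\<close> outside
  \<open>P\<close> vanish, and reindexing turns the rest into the right-hand sum restricted to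
  points whose translate stays in \<open>P\<close>. The terms missing from it are nonnegative, and a
  single positive one makes the inequality strict.\<close>

lemma sum_translate_le:
  fixes z a :: "'a::ab_group_add \<Rightarrow> real"
  assumes "finite P" and z0: "\<And>x. x \<notin> P \<Longrightarrow> z x = 0"
    and z: "\<And>x. x \<in> P \<Longrightarrow> z x \<ge> 0" and a: "\<And>x. x \<in> P \<Longrightarrow> a (x + e) \<ge> 0"
  shows "(\<Sum>x\<in>P. a x * z (x - e)) \<le> (\<Sum>x\<in>P. a (x + e) * z x)"
    and "w \<in> P \<Longrightarrow> w + e \<notin> P \<Longrightarrow> a (w + e) * z w > 0 \<Longrightarrow>
      (\<Sum>x\<in>P. a x * z (x - e)) < (\<Sum>x\<in>P. a (x + e) * z x)"
proof -
  let ?Q = "{x\<in>P. x + e \<in> P}"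
  have "(\<Sum>x\<in>P. a x * z (x - e)) = (\<Sum>x\<in>{x\<in>P. x - e \<in> P}. a x * z (x - e))"
    using \<open>finite P\<close> z0 by (intro sum.mono_neutral_right) auto
  also have "\<dots> = (\<Sum>x\<in>?Q. a (x + e) * z x)"
    by (rule sum.reindex_bij_witness[where i = "\<lambda>x. x + e" and j = "\<lambda>x. x - e"]) auto
  finally have eq: "(\<Sum>x\<in>P. a x * z (x - e)) = (\<Sum>x\<in>?Q. a (x + e) * z x)" .
  show "(\<Sum>x\<in>P. a x * z (x - e)) \<le> (\<Sum>x\<in>P. a (x + e) * z x)"
    unfolding eq using \<open>finite P\<close> z a by (intro sum_mono2) auto
  assume "w \<in> P" "w + e \<notin> P" "a (w + e) * z w > 0"
  then show "(\<Sum>x\<in>P. a x * z (x - e)) < (\<Sum>x\<in>P. a (x + e) * z x)"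
    unfolding eq using \<open>finite P\<close> z a by (intro sum_strict_mono2[where b = w]) auto
qed

text \<open>With neighbours written as translates by vectors, the argument is free of coordinates.
  Asking only for inequalities lets one statement serve both \<open>y\<close> and
  \<open>- y\<close>.\<close>

lemma grid_supersolution_nonneg:
  fixes y \<gamma> a1 b1 a2 b2 :: "'a::real_vector \<Rightarrow> real" and e1 e2 :: 'a
  assumes fin: "finite \<Omega>" and "e1 \<noteq> 0" and sub: "\<Omega> \<subseteq> G"
    and nbr: "\<And>x. x \<in> \<Omega> \<Longrightarrow> x - e1 \<in> G \<and> x + e1 \<in> G \<and> x - e2 \<in> G \<and> x + e2 \<in> G"
    and bdry: "\<And>x. x \<in> G - \<Omega> \<Longrightarrow> y x \<ge> 0"
    and pos: "\<And>x. x \<in> G \<Longrightarrow> a1 x > 0 \<and> b1 x > 0 \<and> a2 x > 0 \<and> b2 x > 0"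
    and super: "\<And>x. x \<in> \<Omega> \<Longrightarrow>
      a1 x * y (x - e1) + b1 x * y (x + e1) + a2 x * y (x - e2) + b2 x * y (x + e2) \<le> \<gamma> x * y x"
    and dom: "(\<forall>x\<in>\<Omega>. a1 x + a2 x + b1 x + b2 x \<le> \<gamma> x) \<or>
      (\<forall>x\<in>\<Omega>. a1 (x + e1) + b1 (x - e1) + a2 (x + e2) + b2 (x - e2) \<le> \<gamma> x)"
    and x: "x \<in> \<Omega>"
  shows "y x \<ge> 0"
proof (rule ccontr)
  assume "\<not> y x \<ge> 0"
  define P where "P = {x\<in>\<Omega>. y x < 0}"
  define z where "z x = (if x \<in> P then - y x else 0)" for x
  have P: "finite P" "P \<noteq> {}" "\<And>x. x \<in> P \<Longrightarrow> x \<in> \<Omega>"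
    using fin x \<open>\<not> y x \<ge> 0\<close> by (auto simp: P_def)
  have zpos: "z x > 0" if "x \<in> P" for x using that by (simp add: z_def P_def)
  have zneg: "z x = 0" if "x \<notin> P" for x using that by (simp add: z_def)
  \<comment> \<open>A neighbour of a point of \<open>P\<close> may lie outside \<open>P\<close>, but
    there \<open>y\<close> is nonnegative, by the definition of \<open>P\<close> or by the boundary
    condition.\<close>
  have yz: "- y x \<le> z x" if "x \<in> G" for x
    using bdry[of x] that by (auto simp: z_def P_def)
  have nbrs: "x - e1 \<in> G" "x + e1 \<in> G" "x - e2 \<in> G" "x + e2 \<in> G" "x \<in> G" if "x \<in> P" for x
    using nbr P(3) sub that by auto
  \<comment> \<open>The shifted points may lie on the boundary, so this relies on positivity of the
    coefficients on all of \<open>G\<close>.\<close>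
  have posP: "a1 x > 0" "b1 x > 0" "a2 x > 0" "b2 x > 0"
    "a1 (x + e1) > 0" "b1 (x - e1) > 0" "a2 (x + e2) > 0" "b2 (x - e2) > 0" if "x \<in> P" for x
    using pos nbrs[OF that] by auto
  have sub_z: "\<gamma> x * z x \<le>
      a1 x * z (x - e1) + b1 x * z (x + e1) + a2 x * z (x - e2) + b2 x * z (x + e2)"
    if "x \<in> P" for x
  proof -
    have "\<gamma> x * z x = - (\<gamma> x * y x)" using that by (simp add: z_def)
    also have "\<dots> \<le> a1 x * - y (x - e1) + b1 x * - y (x + e1) + a2 x * - y (x - e2)
        + b2 x * - y (x + e2)"
      using super[OF P(3)[OF that]] by simp
    also have "\<dots> \<le> a1 x * z (x - e1) + b1 x * z (x + e1) + a2 x * z (x - e2) + b2 x * z (x + e2)"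
      using posP[OF that] yz nbrs[OF that]
      by (intro add_mono mult_left_mono) (simp_all add: less_imp_le)
    finally show ?thesis .
  qed
  from dom show False
  proof
    assume row: "\<forall>x\<in>\<Omega>. a1 x + a2 x + b1 x + b2 x \<le> \<gamma> x"
    define m where "m = Max (z ` P)"
    define M where "M = {x\<in>P. z x = m}"
    have "m \<in> z ` P" unfolding m_def using P by (intro Max_in) auto
    then have M: "finite M" "M \<noteq> {}" and "m > 0"
      using P zpos by (auto simp: M_def)
    have le: "z x \<le> m" for x
      using P zneg[of x] \<open>m > 0\<close> by (cases "x \<in> P") (auto simp: m_def)
    \<comment> \<open>At this maximiser the neighbour \<open>w - e1\<close> has a strictly smaller
      value of \<open>z\<close>, while the other three are at most \<open>m\<close>; since
      \<open>a1 w > 0\<close>, the weighted sum is strictly below the row sum times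
      \<open>m\<close>.\<close>
    obtain w where w: "w \<in> M" "w + (- e1) \<notin> M"
      using finite_exit_translation[OF M, of "- e1"] \<open>e1 \<noteq> 0\<close> by auto
    then have wP: "w \<in> P" "z w = m" by (auto simp: M_def)
    have "z (w - e1) \<noteq> m"
      using w zneg[of "w - e1"] \<open>m > 0\<close> by (auto simp: M_def)
    then have "z (w - e1) < m" using le[of "w - e1"] by simp
    have "\<gamma> w * m \<le>
        a1 w * z (w - e1) + b1 w * z (w + e1) + a2 w * z (w - e2) + b2 w * z (w + e2)"
      using sub_z[OF wP(1)] wP(2) by simp
    also have "\<dots> < a1 w * m + b1 w * m + a2 w * m + b2 w * m"
      using posP[OF wP(1)] le \<open>z (w - e1) < m\<close>
      by (intro add_less_le_mono mult_left_mono mult_strict_left_mono) (simp_all add: less_imp_le)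
    also have "\<dots> = (a1 w + a2 w + b1 w + b2 w) * m" by (simp add: algebra_simps)
    also have "\<dots> \<le> \<gamma> w * m"
      using row P(3)[OF wP(1)] \<open>m > 0\<close> by (intro mult_right_mono) auto
    finally show False by simp
  next
    assume col: "\<forall>x\<in>\<Omega>. a1 (x + e1) + b1 (x - e1) + a2 (x + e2) + b2 (x - e2) \<le> \<gamma> x"
    \<comment> \<open>The positive term \<open>a1 (w + e1) * z w\<close> is lost when the
      \<open>a1\<close> sum is shifted, which supplies the strict inequality below.\<close>
    obtain w where w: "w \<in> P" "w + e1 \<notin> P"
      using finite_exit_translation[OF P(1,2) \<open>e1 \<noteq> 0\<close>] by auto
    note tr = P(1) zneg less_imp_le[OF zpos]
    \<comment> \<open>The form \<open>x - - e1\<close> presents the forward neighbour as a backward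
      shift by \<open>- e1\<close>, so that \<open>sum_translate_le\<close> covers all four
      sums.\<close>
    have "(\<Sum>x\<in>P. \<gamma> x * z x) \<le> (\<Sum>x\<in>P. a1 x * z (x - e1)) + (\<Sum>x\<in>P. b1 x * z (x - - e1))
        + (\<Sum>x\<in>P. a2 x * z (x - e2)) + (\<Sum>x\<in>P. b2 x * z (x - - e2))"
      using sum_mono[OF sub_z, of P] by (simp add: sum.distrib)
    also have "\<dots> < (\<Sum>x\<in>P. a1 (x + e1) * z x) + (\<Sum>x\<in>P. b1 (x + - e1) * z x)
        + (\<Sum>x\<in>P. a2 (x + e2) * z x) + (\<Sum>x\<in>P. b2 (x + - e2) * z x)"
    proof (intro add_less_le_mono sum_translate_le(1)[OF tr])
      show "(\<Sum>x\<in>P. a1 x * z (x - e1)) < (\<Sum>x\<in>P. a1 (x + e1) * z x)"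
        by (rule sum_translate_le(2)[OF tr _ w]) (use posP w(1) zpos in \<open>auto simp: less_imp_le\<close>)
    qed (use posP in \<open>auto simp: less_imp_le\<close>)
    also have "\<dots> = (\<Sum>x\<in>P. (a1 (x + e1) + b1 (x - e1) + a2 (x + e2) + b2 (x - e2)) * z x)"
      by (simp add: sum.distrib distrib_right)
    also have "\<dots> \<le> (\<Sum>x\<in>P. \<gamma> x * z x)"
      using col P(3) zpos by (intro sum_mono mult_right_mono) (auto simp: less_imp_le)
    finally show False by simp
  qed
qed

lemma finite_interior_grid: "finite (interior_grid h1 N1 h2 N2)"
proof -
  have "interior_nodes_1d h N = (\<lambda>i. real i * h) ` {1..N - 1}" for h N
    by (auto simp: interior_nodes_1d_def)
  then show ?thesis by (simp add: interior_grid_def)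
qed

lemma interior_nodes_1d_neighbours:
  assumes "t \<in> interior_nodes_1d h N"
  shows "t \<in> nodes_1d h N" "t - h \<in> nodes_1d h N" "t + h \<in> nodes_1d h N"
proof -
  obtain i where i: "t = real i * h" "1 \<le> i" "i \<le> N - 1"
    using assms by (auto simp: interior_nodes_1d_def)
  then have "t - h = real (i - 1) * h" "t + h = real (i + 1) * h"
    by (simp_all add: algebra_simps of_nat_diff)
  \<comment> \<open>Since \<open>1 \<le> i \<le> N - 1\<close>, neither natural subtraction is
    truncated, and the forward neighbour has index at most \<open>N\<close>.\<close>
  moreover have "i \<le> N" "i - 1 \<le> N" "i + 1 \<le> N" using i by auto
  ultimately show "t \<in> nodes_1d h N" "t - h \<in> nodes_1d h N" "t + h \<in> nodes_1d h N"
    using i(1) unfolding nodes_1d_def by blast+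
qed

theorem theorem5:
  fixes l1 l2 h1 h2 :: real
    and N1 N2 :: nat
    and \<omega> \<Gamma> :: "(real \<times> real) set"
    and y \<phi> \<gamma> \<alpha>1 \<alpha>2 \<beta>1 \<beta>2 :: "real \<times> real \<Rightarrow> real"
  assumes "l1 > 0" and "l2 > 0"
    and "N1 \<ge> 2" and "N2 \<ge> 2"
    and "h1 = l1 / real N1" and "h2 = l2 / real N2"
    and "\<omega> = interior_grid h1 N1 h2 N2"
    and "\<Gamma> = boundary_grid h1 N1 h2 N2"
    and equation: "\<And>x1 x2. (x1, x2) \<in> \<omega> \<Longrightarrow>
      \<gamma> (x1, x2) * y (x1, x2)
        - \<alpha>1 (x1, x2) * y (x1 - h1, x2) - \<beta>1 (x1, x2) * y (x1 + h1, x2)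
        - \<alpha>2 (x1, x2) * y (x1, x2 - h2) - \<beta>2 (x1, x2) * y (x1, x2 + h2)
      = \<phi> (x1, x2)"
    and boundary: "\<And>x. x \<in> \<Gamma> \<Longrightarrow> y x = 0"
    and "\<And>x. x \<in> \<omega> \<Longrightarrow> \<gamma> x > 0"
    and "\<And>x. x \<in> \<omega> \<union> \<Gamma> \<Longrightarrow> \<alpha>1 x > 0 \<and> \<beta>1 x > 0 \<and> \<alpha>2 x > 0 \<and> \<beta>2 x > 0"
    and dominance:
      "(\<forall>x\<in>\<omega>. \<gamma> x \<ge> \<alpha>1 x + \<alpha>2 x + \<beta>1 x + \<beta>2 x) \<or>
       (\<forall>x1 x2. (x1, x2) \<in> \<omega> \<longrightarrow>
          \<gamma> (x1, x2) \<ge> \<alpha>1 (x1 + h1, x2) + \<beta>1 (x1 - h1, x2)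
            + \<alpha>2 (x1, x2 + h2) + \<beta>2 (x1, x2 - h2))"
  shows "((\<forall>x\<in>\<omega>. \<phi> x \<ge> 0) \<longrightarrow> (\<forall>x\<in>\<omega>. y x \<ge> 0)) \<and>
         ((\<forall>x\<in>\<omega>. \<phi> x \<le> 0) \<longrightarrow> (\<forall>x\<in>\<omega>. y x \<le> 0))"
proof -
  let ?G = "grid h1 N1 h2 N2"
  let ?e1 = "(h1, 0) :: real \<times> real" and ?e2 = "(0, h2) :: real \<times> real"
  have sub: "\<omega> \<subseteq> ?G"
    using assms(7) interior_nodes_1d_neighbours(1) by (auto simp: interior_grid_def grid_def)
  have G: "?G = \<omega> \<union> \<Gamma>" using sub assms(7,8) by (auto simp: boundary_grid_def)
  have nbr: "x - ?e1 \<in> ?G \<and> x + ?e1 \<in> ?G \<and> x - ?e2 \<in> ?G \<and> x + ?e2 \<in> ?G" if "x \<in> \<omega>" for x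
    using that assms(7) interior_nodes_1d_neighbours
    by (cases x) (auto simp: interior_grid_def grid_def)
  have "h1 > 0" using assms(1,3,5) by simp
  have dom: "(\<forall>x\<in>\<omega>. \<alpha>1 x + \<alpha>2 x + \<beta>1 x + \<beta>2 x \<le> \<gamma> x) \<or>
      (\<forall>x\<in>\<omega>. \<alpha>1 (x + ?e1) + \<beta>1 (x - ?e1) + \<alpha>2 (x + ?e2) + \<beta>2 (x - ?e2) \<le> \<gamma> x)"
    using dominance by auto
  have eq: "\<alpha>1 x * y (x - ?e1) + \<beta>1 x * y (x + ?e1) + \<alpha>2 x * y (x - ?e2) + \<beta>2 x * y (x + ?e2)
      = \<gamma> x * y x - \<phi> x" if "x \<in> \<omega>" for x
    using that equation[of "fst x" "snd x"] by (cases x) simp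
  \<comment> \<open>Kept general in \<open>u\<close>: it is applied to \<open>y\<close> when \<phi>
    is nonnegative and to \<open>- y\<close> when \<phi> is nonpositive.\<close>
  have key: "u x \<ge> 0"
    if u0: "\<And>x. x \<in> \<Gamma> \<Longrightarrow> u x = 0" and "x \<in> \<omega>"
      and super: "\<And>x. x \<in> \<omega> \<Longrightarrow> \<alpha>1 x * u (x - ?e1) + \<beta>1 x * u (x + ?e1)
        + \<alpha>2 x * u (x - ?e2) + \<beta>2 x * u (x + ?e2) \<le> \<gamma> x * u x"
    for u :: "real \<times> real \<Rightarrow> real" and x
  proof (rule grid_supersolution_nonneg[OF _ _ sub nbr _ _ super dom \<open>x \<in> \<omega>\<close>])
    show "finite \<omega>" using assms(7) finite_interior_grid by simp
    show "?e1 \<noteq> 0" using \<open>h1 > 0\<close> by (simp add: prod_eq_iff)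
    show "u x \<ge> 0" if "x \<in> ?G - \<omega>" for x
    proof -
      have "x \<in> \<Gamma>" using that G by blast
      then show ?thesis using u0 by simp
    qed
    show "\<alpha>1 x > 0 \<and> \<beta>1 x > 0 \<and> \<alpha>2 x > 0 \<and> \<beta>2 x > 0" if "x \<in> ?G" for x
      using that G assms(12) by simp
  qed
  show ?thesis
  proof (intro conjI impI ballI)
    fix x assume \<phi>: "\<forall>x\<in>\<omega>. \<phi> x \<ge> 0" and "x \<in> \<omega>"
    show "y x \<ge> 0"
    proof (rule key[OF boundary \<open>x \<in> \<omega>\<close>])
      fix x assume x: "x \<in> \<omega>"
      show "\<alpha>1 x * y (x - ?e1) + \<beta>1 x * y (x + ?e1)
          + \<alpha>2 x * y (x - ?e2) + \<beta>2 x * y (x + ?e2) \<le> \<gamma> x * y x"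
        using eq[OF x] bspec[OF \<phi> x] by linarith
    qed
  next
    fix x assume \<phi>: "\<forall>x\<in>\<omega>. \<phi> x \<le> 0" and "x \<in> \<omega>"
    have "- y x \<ge> 0"
    proof (rule key[OF _ \<open>x \<in> \<omega>\<close>])
      fix x assume x: "x \<in> \<omega>"
      show "\<alpha>1 x * - y (x - ?e1) + \<beta>1 x * - y (x + ?e1)
          + \<alpha>2 x * - y (x - ?e2) + \<beta>2 x * - y (x + ?e2) \<le> \<gamma> x * - y x"
        unfolding mult_minus_right using eq[OF x] bspec[OF \<phi> x] by linarith
    qed (simp add: boundary)
    then show "y x \<le> 0" by simp
  qed
qed

end
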